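(* Let $X$ be a set and let $S\subset Bin(X)$ be a distributive set. (i) If $*\in S$ is invertible in the monoid $Bin(X)$, with inverse $\bar *$, then $S\cup\{\bar *\}$ is also a distributive set. (ii) If $M(S)$ is the submonoid of $Bin(X)$ generated by $S$, then $M(S)$ is a distributive monoid. (iii) If all operations in $S$ are invertible and $G(S)$ is the subgroup of the group of invertible elements of $Bin(X)$ generated by $S$, then $G(S)$ is a distributive group.
   Context: $Bin(X)$ is the set of all binary operations $*:X\times X\to X$, with the monoid structure in which the composition $*_1*_2$ is given by $a\,( *_1*_2)\,b=(a*_1b)*_2b$ and the identity is $*_0$, $a*_0b=a$. An operation $*$ is invertible if it is invertible in this monoid (equivalently, for every $b$ the map $a\mapsto a*b$ is a bijection of $X$). A subset $S\subset Bin(X)$ is a distributive set if for all $*_\alpha,*_\beta\in S$ (including $*_\alpha=*_\beta$) and all $a,b,c\in X$, $(a*_\alpha b)*_\beta c=(a*_\beta c)*_\alpha(b*_\beta c)$. A distributive monoid (resp. group) is a submonoid (resp. subgroup) of $Bin(X)$ that is a distributive set. *)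

theory Defs
  imports "HOL-Algebra.Generated_Groups" "HOL.Hull"
begin

text \<open>
  The underlying set is a carrier \<open>X\<close> and may be empty.  Operations on \<open>X\<close> are extensional
  functions on \<open>X \<times> X\<close>, so that equality in \<open>Bin X\<close> is equality of operations on \<open>X\<close>.
\<close>

definition Bin :: "'a set \<Rightarrow> ('a \<times> 'a \<Rightarrow> 'a) monoid" where
  "Bin X = \<lparr>carrier = X \<times> X \<rightarrow>\<^sub>E X,
            mult = (\<lambda>f g. \<lambda>(a, b)\<in>X \<times> X. g (f (a, b), b)),
            one = (\<lambda>(a, b)\<in>X \<times> X. a)\<rparr>"

lemma monoid_Bin: "monoid (Bin X)"
proof (rule monoidI)
  show "f \<otimes>\<^bsub>Bin X\<^esub> g \<in> carrier (Bin X)"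
    if "f \<in> carrier (Bin X)" "g \<in> carrier (Bin X)" for f g
    using that by (auto simp: Bin_def PiE_iff)
  show "\<one>\<^bsub>Bin X\<^esub> \<in> carrier (Bin X)"
    by (auto simp: Bin_def)
  show "f \<otimes>\<^bsub>Bin X\<^esub> g \<otimes>\<^bsub>Bin X\<^esub> h = f \<otimes>\<^bsub>Bin X\<^esub> (g \<otimes>\<^bsub>Bin X\<^esub> h)"
    if "f \<in> carrier (Bin X)" "g \<in> carrier (Bin X)" "h \<in> carrier (Bin X)" for f g h
    using that by (auto simp: Bin_def PiE_iff fun_eq_iff restrict_def)
  show "\<one>\<^bsub>Bin X\<^esub> \<otimes>\<^bsub>Bin X\<^esub> f = f" "f \<otimes>\<^bsub>Bin X\<^esub> \<one>\<^bsub>Bin X\<^esub> = f"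
    if "f \<in> carrier (Bin X)" for f
    using that by (auto simp: Bin_def PiE_iff extensional_def fun_eq_iff restrict_def)
qed

definition distributive_set :: "'a set \<Rightarrow> ('a \<times> 'a \<Rightarrow> 'a) set \<Rightarrow> bool" where
  "distributive_set X S \<longleftrightarrow>
     S \<subseteq> carrier (Bin X) \<and>
     (\<forall>f\<in>S. \<forall>g\<in>S. \<forall>a\<in>X. \<forall>b\<in>X. \<forall>c\<in>X. g (f (a, b), c) = f (g (a, c), g (b, c)))"

definition distributive_monoid :: "'a set \<Rightarrow> ('a \<times> 'a \<Rightarrow> 'a) set \<Rightarrow> bool" where
  "distributive_monoid X M \<longleftrightarrow> submonoid M (Bin X) \<and> distributive_set X M"

text \<open>
  A subgroup of a monoid is a subgroup of its group of units; the locale \<open>subgroup\<close> is only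
  meaningful over a group, because \<open>inv\<close> is unspecified at elements that are not units.
\<close>

definition distributive_group :: "'a set \<Rightarrow> ('a \<times> 'a \<Rightarrow> 'a) set \<Rightarrow> bool" where
  "distributive_group X G \<longleftrightarrow> subgroup G (units_of (Bin X)) \<and> distributive_set X G"

definition generated_submonoid :: "('a, 'b) monoid_scheme \<Rightarrow> 'a set \<Rightarrow> 'a set" where
  "generated_submonoid G S = (\<lambda>N. submonoid N G) hull S"

end

theory Submission
  imports Defs
begin

text \<open>
  Write \<open>g \<triangleright> f\<close> if \<open>(a f b) g c = (a g c) f (b g c)\<close> for all \<open>a b c\<close>, that is, if every right
  translation \<open>a \<mapsto> a g c\<close> is an endomorphism of \<open>(X, f)\<close>. A set is distributive iff \<open>\<triangleright>\<close> holds
  between any two of its elements. For fixed \<open>f\<close> the operations \<open>g\<close> with \<open>g \<triangleright> f\<close>, and for fixed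
  \<open>g\<close> the operations \<open>f\<close> with \<open>g \<triangleright> f\<close>, form a submonoid of \<open>Bin X\<close> closed under inverses. So
  \<open>\<triangleright>\<close> extends from \<open>S \<times> S\<close> to \<open>\<langle>S\<rangle> \<times> S\<close> and then to \<open>\<langle>S\<rangle> \<times> \<langle>S\<rangle>\<close>.
\<close>

definition distributes_over ::
    "'a set \<Rightarrow> ('a \<times> 'a \<Rightarrow> 'a) \<Rightarrow> ('a \<times> 'a \<Rightarrow> 'a) \<Rightarrow> bool" where
  "distributes_over X g f \<longleftrightarrow>
     (\<forall>a\<in>X. \<forall>b\<in>X. \<forall>c\<in>X. g (f (a, b), c) = f (g (a, c), g (b, c)))"

lemma distributive_set_iff:
  "distributive_set X S \<longleftrightarrow>
     S \<subseteq> carrier (Bin X) \<and> (\<forall>f\<in>S. \<forall>g\<in>S. distributes_over X g f)"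
  by (simp add: distributive_set_def distributes_over_def)

lemma Bin_closed: "f \<in> carrier (Bin X) \<Longrightarrow> a \<in> X \<Longrightarrow> b \<in> X \<Longrightarrow> f (a, b) \<in> X"
  by (auto simp: Bin_def)

lemma Bin_mult_apply:
  "a \<in> X \<Longrightarrow> b \<in> X \<Longrightarrow> (f \<otimes>\<^bsub>Bin X\<^esub> g) (a, b) = g (f (a, b), b)"
  by (simp add: Bin_def)

lemma Bin_one_apply: "a \<in> X \<Longrightarrow> b \<in> X \<Longrightarrow> \<one>\<^bsub>Bin X\<^esub> (a, b) = a"
  by (simp add: Bin_def)

text \<open>Evaluating the two inverse laws at a point: for fixed \<open>b\<close>, right
  translations by \<open>b\<close> under \<open>f\<close> and under its inverse undo each
  other.\<close>

lemma Bin_Units_inv: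
  assumes "f \<in> Units (Bin X)" "a \<in> X" "b \<in> X"
  shows "f ((inv\<^bsub>Bin X\<^esub> f) (a, b), b) = a" "(inv\<^bsub>Bin X\<^esub> f) (f (a, b), b) = a"
  using assms monoid.Units_l_inv[OF monoid_Bin assms(1)] monoid.Units_r_inv[OF monoid_Bin assms(1)]
  by (metis Bin_mult_apply Bin_one_apply)+

lemma Bin_inv_closed: "f \<in> Units (Bin X) \<Longrightarrow> inv\<^bsub>Bin X\<^esub> f \<in> carrier (Bin X)"
  by (rule monoid.Units_inv_closed[OF monoid_Bin])

text \<open>Right translation by \<open>c\<close> under a product is the composite of the two right
  translations by \<open>c\<close>, and endomorphisms of \<open>(X, f)\<close> compose.\<close>

lemma submonoid_left_distributors:
  assumes "F \<subseteq> carrier (Bin X)"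
  shows "submonoid {g \<in> carrier (Bin X). \<forall>f\<in>F. distributes_over X g f} (Bin X)"
  using assms monoid.m_closed[OF monoid_Bin] monoid.one_closed[OF monoid_Bin]
  by unfold_locales (auto simp: distributes_over_def Bin_mult_apply Bin_one_apply Bin_closed subset_iff)

text \<open>A map preserving two operations also preserves every term built from them, in particular
  their product.\<close>

lemma submonoid_right_distributors:
  assumes "F \<subseteq> carrier (Bin X)"
  shows "submonoid {f \<in> carrier (Bin X). \<forall>g\<in>F. distributes_over X g f} (Bin X)"
  using assms monoid.m_closed[OF monoid_Bin] monoid.one_closed[OF monoid_Bin]
  by unfold_locales (auto simp: distributes_over_def Bin_mult_apply Bin_one_apply Bin_closed subset_iff)

text \<open>The inverse of a bijective endomorphism of \<open>(X, f)\<close> is again an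
  endomorphism.\<close>

lemma distributes_over_inv_left:
  assumes g: "g \<in> Units (Bin X)" and f: "f \<in> carrier (Bin X)" and d: "distributes_over X g f"
  shows "distributes_over X (inv\<^bsub>Bin X\<^esub> g) f"
  unfolding distributes_over_def
proof (intro ballI)
  fix a b c assume X: "a \<in> X" "b \<in> X" "c \<in> X"
  let ?h = "inv\<^bsub>Bin X\<^esub> g"
  have h: "?h (a, c) \<in> X" "?h (b, c) \<in> X"
    using X Bin_inv_closed[OF g] by (auto intro: Bin_closed)
  then have "g (f (?h (a, c), ?h (b, c)), c) = f (a, b)"
    using d X by (simp add: distributes_over_def Bin_Units_inv[OF g])
  then show "?h (f (a, b), c) = f (?h (a, c), ?h (b, c))"
    using Bin_Units_inv(2)[OF g Bin_closed[OF f h] X(3)] by simp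
qed

text \<open>Let \<open>p\<close> be right translation by \<open>c\<close> under \<open>g\<close>,
  and \<open>R b\<close> right translation by \<open>b\<close> under \<open>f\<close>. The
  hypothesis says that \<open>p\<close> after \<open>R b\<close> equals \<open>R (p b)\<close> after
  \<open>p\<close>; inverting both translations gives the claim.\<close>

lemma distributes_over_inv_right:
  assumes f: "f \<in> Units (Bin X)" and g: "g \<in> carrier (Bin X)" and d: "distributes_over X g f"
  shows "distributes_over X g (inv\<^bsub>Bin X\<^esub> f)"
  unfolding distributes_over_def
proof (intro ballI)
  fix a b c assume X: "a \<in> X" "b \<in> X" "c \<in> X"
  let ?h = "inv\<^bsub>Bin X\<^esub> f"
  have h: "?h (a, b) \<in> X"
    using X Bin_inv_closed[OF f] by (auto intro: Bin_closed)
  then have "f (g (?h (a, b), c), g (b, c)) = g (f (?h (a, b), b), c)"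
    using d X by (simp add: distributes_over_def)
  also have "\<dots> = g (a, c)"
    using X by (simp add: Bin_Units_inv[OF f])
  finally show "g (?h (a, b), c) = ?h (g (a, c), g (b, c))"
    using Bin_Units_inv(2)[OF f Bin_closed[OF g h X(3)] Bin_closed[OF g X(2,3)]] by simp
qed

lemma distributive_set_insert_inv:
  assumes S: "distributive_set X S" and f: "f \<in> S" "f \<in> Units (Bin X)"
  shows "distributive_set X (S \<union> {inv\<^bsub>Bin X\<^esub> f})"
proof -
  note inv_f = Bin_inv_closed[OF f(2)]
  have right: "distributes_over X g (inv\<^bsub>Bin X\<^esub> f)" if "g \<in> S" for g
    using S f that by (intro distributes_over_inv_right) (auto simp: distributive_set_iff)
  moreover have "distributes_over X (inv\<^bsub>Bin X\<^esub> f) g" if "g \<in> S" for g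
    using S f that by (intro distributes_over_inv_left) (auto simp: distributive_set_iff)
  \<comment> \<open>Invert one argument at a time: \<open>right\<close> at \<open>g = f\<close>
    inverts the operation distributed over, then the distributing one is inverted.\<close>
  moreover have "distributes_over X (inv\<^bsub>Bin X\<^esub> f) (inv\<^bsub>Bin X\<^esub> f)"
    using distributes_over_inv_left[OF f(2) inv_f] right f(1) by blast
  ultimately show ?thesis
    using S inv_f by (auto simp: distributive_set_iff)
qed

lemma generated_submonoid_subset:
  "submonoid N G \<Longrightarrow> S \<subseteq> N \<Longrightarrow> generated_submonoid G S \<subseteq> N"
  unfolding generated_submonoid_def by (rule hull_minimal)

lemma submonoid_generated_submonoid:
  assumes "monoid G" "S \<subseteq> carrier G"
  shows "submonoid (generated_submonoid G S) G"
proof -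
  \<comment> \<open>The carrier is one of the submonoids intersected in the hull, which bounds the
    intersection.\<close>
  have "submonoid (carrier G) G"
    using assms(1) by (simp add: submonoid_def monoid.m_closed monoid.one_closed)
  then have "generated_submonoid G S \<subseteq> carrier G"
    using assms(2) by (rule generated_submonoid_subset)
  then show ?thesis
    by (auto simp: generated_submonoid_def hull_def submonoid_def)
qed

text \<open>The two-stage extension, shared by monoids and groups: \<open>left\<close> and
  \<open>right\<close> are the instances of minimality of \<open>M\<close> that it uses. The second
  stage quantifies over \<open>M\<close>, since the first has already enlarged the distributing
  side.\<close>

lemma distributive_set_extend:
  assumes S: "distributive_set X S" and M: "M \<subseteq> carrier (Bin X)"
    and left: "S \<subseteq> {g \<in> carrier (Bin X). \<forall>f\<in>S. distributes_over X g f} \<Longrightarrow>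
                 M \<subseteq> {g \<in> carrier (Bin X). \<forall>f\<in>S. distributes_over X g f}"
    and right: "S \<subseteq> {f \<in> carrier (Bin X). \<forall>g\<in>M. distributes_over X g f} \<Longrightarrow>
                 M \<subseteq> {f \<in> carrier (Bin X). \<forall>g\<in>M. distributes_over X g f}"
  shows "distributive_set X M"
proof -
  have "M \<subseteq> {g \<in> carrier (Bin X). \<forall>f\<in>S. distributes_over X g f}"
    using S by (intro left) (auto simp: distributive_set_iff)
  then have "M \<subseteq> {f \<in> carrier (Bin X). \<forall>g\<in>M. distributes_over X g f}"
    using S by (intro right) (auto simp: distributive_set_iff)
  then show ?thesis
    by (auto simp: distributive_set_iff)
qed

lemma distributive_monoid_generated:
  assumes S: "distributive_set X S"
  shows "distributive_monoid X (generated_submonoid (Bin X) S)"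
proof -
  have carrier: "S \<subseteq> carrier (Bin X)"
    using S by (simp add: distributive_set_iff)
  note M = submonoid_generated_submonoid[OF monoid_Bin carrier]
  have "distributive_set X (generated_submonoid (Bin X) S)"
    using S submonoid.subset[OF M]
    by (rule distributive_set_extend)
      (intro generated_submonoid_subset submonoid_left_distributors submonoid_right_distributors
        carrier submonoid.subset[OF M]; assumption)+
  with M show ?thesis
    by (simp add: distributive_monoid_def)
qed

text \<open>Minimality of the generated subgroup, for a submonoid \<open>N\<close> that may contain
  non-units: its units form a subgroup of \<open>units_of G\<close>, whose inverses agree with those
  of \<open>G\<close>.\<close>

lemma generate_units_of_subset:
  assumes "monoid G" "S \<subseteq> Units G" "submonoid N G" "S \<subseteq> N"
    and inv: "\<And>x. x \<in> N \<Longrightarrow> x \<in> Units G \<Longrightarrow> inv\<^bsub>G\<^esub> x \<in> N"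
  shows "generate (units_of G) S \<subseteq> N"
proof -
  have "subgroup (N \<inter> Units G) (units_of G)"
    using assms(1,3) inv monoid.units_of_inv[OF assms(1)] monoid.Units_m_closed[OF assms(1)]
      monoid.Units_inv_Units[OF assms(1)] monoid.Units_one_closed[OF assms(1)]
    by (auto simp: subgroup_def submonoid_def units_of_def)
  then show ?thesis
    using group.generate_subgroup_incl[OF monoid.units_group[OF assms(1)]] assms(2,4) by blast
qed

lemma distributive_group_generated:
  assumes S: "distributive_set X S" and units: "S \<subseteq> Units (Bin X)"
  shows "distributive_group X (generate (units_of (Bin X)) S)"
proof -
  let ?G = "generate (units_of (Bin X)) S"
  have carrier: "S \<subseteq> carrier (Bin X)"
    using S by (simp add: distributive_set_iff)
  have G: "subgroup ?G (units_of (Bin X))"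
    using units by (intro group.generate_is_subgroup monoid.units_group monoid_Bin)
      (simp add: units_of_carrier)
  \<comment> \<open>The second stage takes the right distributors relative to all of
    \<open>?G\<close>, so \<open>?G\<close> itself must consist of operations on
    \<open>X\<close>.\<close>
  then have G_carrier: "?G \<subseteq> carrier (Bin X)"
    using subgroup.subset[OF G] by (auto simp: units_of_carrier Units_def)
  have "distributive_set X ?G"
  proof (rule distributive_set_extend[OF S G_carrier])
    assume "S \<subseteq> {g \<in> carrier (Bin X). \<forall>f\<in>S. distributes_over X g f}"
    with submonoid_left_distributors[OF carrier]
    show "?G \<subseteq> {g \<in> carrier (Bin X). \<forall>f\<in>S. distributes_over X g f}"
      by (rule generate_units_of_subset[OF monoid_Bin units])
        (use carrier in \<open>auto intro: Bin_inv_closed distributes_over_inv_left\<close>)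
  next
    assume "S \<subseteq> {f \<in> carrier (Bin X). \<forall>g\<in>?G. distributes_over X g f}"
    with submonoid_right_distributors[OF G_carrier]
    show "?G \<subseteq> {f \<in> carrier (Bin X). \<forall>g\<in>?G. distributes_over X g f}"
      by (rule generate_units_of_subset[OF monoid_Bin units])
        (use G_carrier in \<open>auto intro: Bin_inv_closed distributes_over_inv_right\<close>)
  qed
  with G show ?thesis
    by (simp add: distributive_group_def)
qed

theorem proposition2p4:
  fixes X :: "'a set" and S :: "('a \<times> 'a \<Rightarrow> 'a) set"
  assumes "distributive_set X S"
  shows "(\<forall>f\<in>S. f \<in> Units (Bin X) \<longrightarrow> distributive_set X (S \<union> {inv\<^bsub>Bin X\<^esub> f}))
       \<and> distributive_monoid X (generated_submonoid (Bin X) S)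
       \<and> (S \<subseteq> Units (Bin X) \<longrightarrow> distributive_group X (generate (units_of (Bin X)) S))"
  using assms distributive_set_insert_inv distributive_monoid_generated
    distributive_group_generated by blast

end
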